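(* Let $h:\mathbb{R}^m\to\mathbb{R}$ be prox-bounded, let $g:\mathbb{R}^n\to\mathbb{R}$ be convex, and let $A\in\mathbb{R}^{m\times n}$. Let $w^0\in\mathbb{R}^m$ and let $(w^k)_{k\ge 0}$, $(x^k)_{k\ge0}$ be generated by $$x^k\in\operatorname*{argmin}_{x}\ g(x)+\frac{1}{2\nu}\|Ax-w^k\|^2,\qquad w^{k+1}\in\mathrm{prox}_{\nu h}\big(w^k-\nu\nabla g_\nu(w^k)\big)=\mathrm{prox}_{\nu h}(Ax^k).$$ Then for every $k\ge 1$, $$\frac{1}{\nu}A(x^{k-1}-x^k)\in\partial h(w^k)+\frac1\nu(w^k-Ax^k),\qquad\text{where}\qquad 0\in\partial g(x^k)+\frac1\nu A^\top(Ax^k-w^k).$$ Moreover, for every $k\ge1$, $$\frac1k\sum_{i=1}^kT_\nu(w^i)\ \le\ \frac1k\sum_{i=1}^k\Big\|\frac1\nu A(x^{i-1}-x^i)\Big\|^2\ \le\ \frac{2}{\nu k}\big[p_\nu(w^0)-p_\nu^*\big].$$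
   Context: $\|\cdot\|$ is the Euclidean norm; $\partial$ denotes the limiting subdifferential: $v\in\partial f(\bar x)$ iff there are $x_i\to\bar x$ with $f(x_i)\to f(\bar x)$ and Fréchet subgradients $v_i\in\hat\partial f(x_i)$ with $v_i\to v$, where $v\in\hat\partial f(\bar x)$ means $f(x)\ge f(\bar x)+\langle v,x-\bar x\rangle+o(\|x-\bar x\|)$ as $x\to\bar x$ (for convex $f$ this is the usual subdifferential). Standing assumptions: $h$ and $g$ are closed (lower semicontinuous) and proper; $h$ is separable, $h(w)=\sum_{i=1}^m h_i(w_i)$ (it may be nonsmooth and nonconvex). $\mathrm{prox}_{\nu h}(y)=\operatorname{argmin}_w\{h(w)+\frac1{2\nu}\|w-y\|^2\}$ (a set in general). Prox-boundedness of $h$ means that there is $\bar\nu>0$ such that $\mathrm{prox}_{\nu h}(y)$ is nonempty for all $y$ and all $0<\nu<\bar\nu$; the parameter $\nu>0$ is fixed such that $\mathrm{prox}_{\nu h}(y)\neq\emptyset$ for all $y$. $g_\nu(w)=\min_x\{g(x)+\frac1{2\nu}\|Ax-w\|^2\}$, where the minimizers $x^k$ above are assumed to exist; $g_\nu$ is differentiable, with $\nabla g_\nu(w)=\frac1\nu(w-Ax)$ for any minimizer $x$. $p_\nu(w)=h(w)+g_\nu(w)$ is assumed bounded below with attained minimum, and $p_\nu^*=\min_w p_\nu(w)$. The optimality measure is $T_\nu(w)=\min\{\|v\|^2: v\in\partial h(w)+\nabla g_\nu(w)\}$. *)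

theory Defs
  imports "HOL-Analysis.Analysis" "HOL-Library.Landau_Symbols"
begin

text \<open>Functions are extended-real-valued; a real-valued function \<open>f\<close> is covered by
  \<open>\<lambda>x. ereal (f x)\<close>.\<close>

definition proper :: "('a \<Rightarrow> ereal) \<Rightarrow> bool" where
  "proper f \<longleftrightarrow> (\<forall>x. f x \<noteq> -\<infinity>) \<and> (\<exists>x. f x \<noteq> \<infinity>)"

definition lsc :: "('a::topological_space \<Rightarrow> ereal) \<Rightarrow> bool" where
  "lsc f \<longleftrightarrow> (\<forall>x. f x \<le> Liminf (at x) f)"

text \<open>Only \<open>0 < t < 1\<close> is considered, so that no product \<open>0 * \<infinity>\<close> occurs; the function
  is meant to be proper, so that no sum \<open>\<infinity> + (-\<infinity>)\<close> occurs.\<close>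

definition ereal_convex :: "('a::real_vector \<Rightarrow> ereal) \<Rightarrow> bool" where
  "ereal_convex f \<longleftrightarrow> (\<forall>x y t. 0 < t \<and> t < 1 \<longrightarrow>
     f ((1 - t) *\<^sub>R x + t *\<^sub>R y) \<le> ereal (1 - t) * f x + ereal t * f y)"

definition separable :: "(real ^ 'm \<Rightarrow> ereal) \<Rightarrow> bool" where
  "separable h \<longleftrightarrow> (\<exists>hs :: 'm \<Rightarrow> real \<Rightarrow> ereal. \<forall>w. h w = (\<Sum>i\<in>UNIV. hs i (w $ i)))"

definition argmin_set :: "('a \<Rightarrow> ereal) \<Rightarrow> 'a set" where
  "argmin_set f = {x. is_arg_min f (\<lambda>_. True) x}"

definition frechet_subdiff :: "('a::real_inner \<Rightarrow> ereal) \<Rightarrow> 'a \<Rightarrow> 'a set" where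
  "frechet_subdiff f xbar = {v. \<bar>f xbar\<bar> \<noteq> \<infinity> \<and>
     (\<exists>r :: 'a \<Rightarrow> real. r \<in> o[at xbar](\<lambda>x. norm (x - xbar)) \<and>
        (\<forall>\<^sub>F x in at xbar. f x \<ge> f xbar + ereal (v \<bullet> (x - xbar) + r x)))}"

text \<open>As usual, the subdifferential is empty at points where \<open>f\<close> is not finite.\<close>

definition lim_subdiff :: "('a::real_inner \<Rightarrow> ereal) \<Rightarrow> 'a \<Rightarrow> 'a set" where
  "lim_subdiff f xbar = {v. \<bar>f xbar\<bar> \<noteq> \<infinity> \<and>
     (\<exists>(X :: nat \<Rightarrow> 'a) (V :: nat \<Rightarrow> 'a).
        X \<longlonglongrightarrow> xbar \<and> (\<lambda>i. f (X i)) \<longlonglongrightarrow> f xbar \<and>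
        (\<forall>i. V i \<in> frechet_subdiff f (X i)) \<and> V \<longlonglongrightarrow> v)}"

definition prox :: "real \<Rightarrow> ('a::real_normed_vector \<Rightarrow> ereal) \<Rightarrow> 'a \<Rightarrow> 'a set" where
  "prox \<nu> h y = argmin_set (\<lambda>w. h w + ereal (1 / (2 * \<nu>) * (norm (w - y))\<^sup>2))"

definition prox_bounded :: "('a::real_normed_vector \<Rightarrow> ereal) \<Rightarrow> bool" where
  "prox_bounded h \<longleftrightarrow> (\<exists>\<nu>bar>0. \<forall>y \<nu>. 0 < \<nu> \<and> \<nu> < \<nu>bar \<longrightarrow> prox \<nu> h y \<noteq> {})"

definition gradient :: "('a::real_inner \<Rightarrow> real) \<Rightarrow> 'a \<Rightarrow> 'a" where
  "gradient f x = (THE D. GDERIV f x :> D)"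

definition penalized ::
    "real \<Rightarrow> (real ^ 'n \<Rightarrow> ereal) \<Rightarrow> real ^ 'n ^ 'm \<Rightarrow> real ^ 'm \<Rightarrow> real ^ 'n \<Rightarrow> ereal" where
  "penalized \<nu> g A w x = g x + ereal (1 / (2 * \<nu>) * (norm (A *v x - w))\<^sup>2)"

definition g_env ::
    "real \<Rightarrow> (real ^ 'n \<Rightarrow> ereal) \<Rightarrow> real ^ 'n ^ 'm \<Rightarrow> real ^ 'm \<Rightarrow> ereal" where
  "g_env \<nu> g A w = (INF x. penalized \<nu> g A w x)"

text \<open>For proper convex \<open>g\<close> the function \<open>g_env \<nu> g A\<close> is finite everywhere as soon as the
  infimum defining it is attained for one \<open>w\<close>, so \<open>real_of_ereal\<close> loses no information.\<close>

definition grad_g_env ::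
    "real \<Rightarrow> (real ^ 'n \<Rightarrow> ereal) \<Rightarrow> real ^ 'n ^ 'm \<Rightarrow> real ^ 'm \<Rightarrow> real ^ 'm" where
  "grad_g_env \<nu> g A w = gradient (\<lambda>u. real_of_ereal (g_env \<nu> g A u)) w"

definition p_obj ::
    "real \<Rightarrow> (real ^ 'm \<Rightarrow> ereal) \<Rightarrow> (real ^ 'n \<Rightarrow> ereal) \<Rightarrow> real ^ 'n ^ 'm \<Rightarrow> real ^ 'm \<Rightarrow> ereal" where
  "p_obj \<nu> h g A w = h w + g_env \<nu> g A w"

definition p_star ::
    "real \<Rightarrow> (real ^ 'm \<Rightarrow> ereal) \<Rightarrow> (real ^ 'n \<Rightarrow> ereal) \<Rightarrow> real ^ 'n ^ 'm \<Rightarrow> ereal" where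
  "p_star \<nu> h g A = (INF w. p_obj \<nu> h g A w)"

definition T_set ::
    "real \<Rightarrow> (real ^ 'm \<Rightarrow> ereal) \<Rightarrow> (real ^ 'n \<Rightarrow> ereal) \<Rightarrow> real ^ 'n ^ 'm \<Rightarrow> real ^ 'm \<Rightarrow> (real ^ 'm) set" where
  "T_set \<nu> h g A w = (\<lambda>s. s + grad_g_env \<nu> g A w) ` lim_subdiff h w"

text \<open>The infimum over the empty set is \<open>\<infinity>\<close>; otherwise it is a minimum, see
  \<open>T_opt_attained\<close> below.\<close>

definition T_opt ::
    "real \<Rightarrow> (real ^ 'm \<Rightarrow> ereal) \<Rightarrow> (real ^ 'n \<Rightarrow> ereal) \<Rightarrow> real ^ 'n ^ 'm \<Rightarrow> real ^ 'm \<Rightarrow> ereal" where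
  "T_opt \<nu> h g A w = (INF v\<in>T_set \<nu> h g A w. ereal ((norm v)\<^sup>2))"

lemma closed_lim_subdiff:
  fixes f :: "'a::real_inner \<Rightarrow> ereal"
  shows "closed (lim_subdiff f x)"
proof -
  have "v \<in> lim_subdiff f x"
    if s: "\<forall>n. s n \<in> lim_subdiff f x" and lim: "s \<longlonglongrightarrow> v" for s v
  proof -
    have fin: "\<bar>f x\<bar> \<noteq> \<infinity>" using s by (auto simp: lim_subdiff_def)
    then obtain a where a: "f x = ereal a" by (cases "f x") auto
    have ex: "\<exists>y u. dist y x < e \<and> ereal (a - e) < f y \<and> f y < ereal (a + e) \<and>
            u \<in> frechet_subdiff f y \<and> dist u (s n) < e" if e: "0 < e" for e n
    proof -
      from s obtain X V where X: "X \<longlonglongrightarrow> x" "(\<lambda>i. f (X i)) \<longlonglongrightarrow> f x"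
        "\<forall>i. V i \<in> frechet_subdiff f (X i)" "V \<longlonglongrightarrow> s n"
        unfolding lim_subdiff_def by blast
      have lo: "ereal (a - e) < f x" and hi: "f x < ereal (a + e)" using e by (simp_all add: a)
      have "\<forall>\<^sub>F i in sequentially. dist (X i) x < e \<and> dist (V i) (s n) < e \<and>
          ereal (a - e) < f (X i) \<and> f (X i) < ereal (a + e)"
        by (intro eventually_conj tendstoD[OF X(1) e] tendstoD[OF X(4) e]
            order_tendstoD(1)[OF X(2) lo] order_tendstoD(2)[OF X(2) hi])
      from eventually_happens'[OF sequentially_bot this] obtain i where
        "dist (X i) x < e \<and> dist (V i) (s n) < e \<and>
          ereal (a - e) < f (X i) \<and> f (X i) < ereal (a + e)" ..
      then show ?thesis using X(3) by (intro exI[of _ "X i"] exI[of _ "V i"]) simp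
    qed
    define d where "d n = inverse (real (Suc n))" for n
    have d_pos: "0 < d n" for n by (simp add: d_def)
    have d_lim: "d \<longlonglongrightarrow> 0" unfolding d_def by (rule LIMSEQ_inverse_real_of_nat)
    have "\<forall>n. \<exists>q. dist (fst q) x < d n \<and> ereal (a - d n) < f (fst q) \<and> f (fst q) < ereal (a + d n) \<and>
            snd q \<in> frechet_subdiff f (fst q) \<and> dist (snd q) (s n) < d n"
      using ex[OF d_pos] by simp
    from choice[OF this] obtain Q where Q: "\<forall>n. dist (fst (Q n)) x < d n \<and>
            ereal (a - d n) < f (fst (Q n)) \<and> f (fst (Q n)) < ereal (a + d n) \<and>
            snd (Q n) \<in> frechet_subdiff f (fst (Q n)) \<and> dist (snd (Q n)) (s n) < d n" ..
    define Y where "Y n = fst (Q n)" for n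
    define U where "U n = snd (Q n)" for n
    have YU: "dist (Y n) x \<le> d n" "ereal (a - d n) \<le> f (Y n)" "f (Y n) \<le> ereal (a + d n)"
        "U n \<in> frechet_subdiff f (Y n)" "dist (U n) (s n) \<le> d n" for n
      using Q[rule_format, of n] by (simp_all add: Y_def U_def less_imp_le)
    have "(\<lambda>n. dist (Y n) x) \<longlonglongrightarrow> 0"
      by (rule tendsto_sandwich[OF always_eventually always_eventually tendsto_const d_lim])
        (simp_all add: YU(1))
    then have 1: "Y \<longlonglongrightarrow> x" by (rule iffD2[OF tendsto_dist_iff])
    have "(\<lambda>n. dist (U n) (s n)) \<longlonglongrightarrow> 0"
      by (rule tendsto_sandwich[OF always_eventually always_eventually tendsto_const d_lim])
        (simp_all add: YU(5))
    then have "(\<lambda>n. U n - s n) \<longlonglongrightarrow> 0"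
      unfolding dist_norm by (rule tendsto_norm_zero_cancel)
    from tendsto_add[OF this lim] have 2: "U \<longlonglongrightarrow> v" by simp
    have "(\<lambda>n. a - d n) \<longlonglongrightarrow> a" "(\<lambda>n. a + d n) \<longlonglongrightarrow> a"
      using tendsto_diff[OF tendsto_const[of a] d_lim] tendsto_add[OF tendsto_const[of a] d_lim]
      by simp_all
    from this[THEN tendsto_ereal, folded a]
    have L: "(\<lambda>n. ereal (a - d n)) \<longlonglongrightarrow> f x" "(\<lambda>n. ereal (a + d n)) \<longlonglongrightarrow> f x" .
    have 3: "(\<lambda>n. f (Y n)) \<longlonglongrightarrow> f x"
      by (rule tendsto_sandwich[OF always_eventually always_eventually L]) (simp_all add: YU(2,3))
    show ?thesis unfolding lim_subdiff_def using fin 1 2 3 YU(4)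
      by (intro CollectI conjI exI[of _ Y] exI[of _ U]) simp_all
  qed
  then show ?thesis unfolding closed_sequential_limits by (intro allI impI) (elim conjE)
qed

lemma T_opt_attained:
  assumes "lim_subdiff h w \<noteq> {}"
  shows "\<exists>v\<in>T_set \<nu> h g A w. T_opt \<nu> h g A w = ereal ((norm v)\<^sup>2)"
proof -
  let ?c = "grad_g_env \<nu> g A w"
  have "T_set \<nu> h g A w = (+) ?c ` lim_subdiff h w"
    by (simp add: T_set_def add.commute)
  then have cl: "closed (T_set \<nu> h g A w)"
    by (simp add: closed_translation closed_lim_subdiff)
  have ne: "T_set \<nu> h g A w \<noteq> {}" using assms by (simp add: T_set_def)
  obtain v where v: "v \<in> T_set \<nu> h g A w" "\<forall>y\<in>T_set \<nu> h g A w. dist 0 v \<le> dist 0 y"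
    by (rule distance_attains_inf[OF cl ne, of 0]) simp
  have "T_opt \<nu> h g A w = ereal ((norm v)\<^sup>2)" unfolding T_opt_def
  proof (rule antisym)
    show "(INF v\<in>T_set \<nu> h g A w. ereal ((norm v)\<^sup>2)) \<le> ereal ((norm v)\<^sup>2)"
      by (rule INF_lower) (rule v(1))
    show "ereal ((norm v)\<^sup>2) \<le> (INF v\<in>T_set \<nu> h g A w. ereal ((norm v)\<^sup>2))"
      by (rule INF_greatest) (use v(2) in \<open>simp add: power_mono\<close>)
  qed
  then show ?thesis using v(1) by blast
qed

end

theory Submission
  imports Defs
begin

text \<open>
  Everything rests on one quadratic growth estimate.  Let \<open>x\<close> minimize
  \<open>g z + \<parallel>A z - w\<parallel>\<^sup>2 / (2\<nu>)\<close>.  Testing this minimality along the segments from \<open>x\<close>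
  and using convexity of \<open>g\<close> shows that \<open>A\<^sup>T (w - A x) / \<nu>\<close> is a (global) subgradient of
  \<open>g\<close> at \<open>x\<close>.  Completing the square in this subgradient inequality gives, for all \<open>z\<close> and
  all \<open>u\<close>,
  \<open>g z + \<parallel>A z - u\<parallel>\<^sup>2 / (2\<nu>) \<ge> g_env w + \<langle>w - A x, u - w\<rangle> / \<nu>
      + \<parallel>A z - A x - (u - w)\<parallel>\<^sup>2 / (2\<nu>)\<close>,
  which is the lemma \<open>penalized_growth\<close>.  It is used in two ways.

  Dropping the last square and minimizing over \<open>z\<close> yields an affine minorant of \<open>g_env\<close>
  that is exact at \<open>w\<close>; inserting \<open>z = x\<close> in the definition of \<open>g_env\<close> yields a majorant
  that differs from it by \<open>\<parallel>u - w\<parallel>\<^sup>2 / (2\<nu>)\<close>.  Squeezed between the two, \<open>g_env\<close> has the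
  gradient \<open>(w - A x) / \<nu>\<close> at \<open>w\<close>, so that the proximal gradient step is a proximal step from
  \<open>A x\<close>, and both inclusions are Fermat's rule for the two minimization problems
  (\<open>lim_subdiff_prox\<close>, \<open>lim_subdiff_penalized\<close>).

  Taking \<open>u = w\<close> instead, the inequality says that replacing the old minimizer \<open>x k\<close> by
  \<open>x (k + 1)\<close> at the point \<open>w (k + 1)\<close> gains at least
  \<open>\<parallel>A (x k - x (k + 1))\<parallel>\<^sup>2 / (2\<nu>)\<close>.  Together with the minimality of \<open>w (k + 1)\<close> in the
  proximal problem, which compares \<open>w (k + 1)\<close> with \<open>w k\<close>, this is the sufficient decrease
  of \<open>p_obj\<close> (\<open>p_obj_decrease\<close>); telescoping it gives the rate.
\<close>

section \<open>Minimizers of a function plus a finite function\<close>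

lemma argmin_set_iff: "x \<in> argmin_set f \<longleftrightarrow> (\<forall>y. f x \<le> f y)"
  by (auto simp: argmin_set_def is_arg_min_def not_less)

lemma argmin_add_real_finite:
  assumes "proper f" and min: "x \<in> argmin_set (\<lambda>z. f z + ereal (q z))"
  shows "\<bar>f x\<bar> \<noteq> \<infinity>"
proof -
  from \<open>proper f\<close> obtain z where z: "f z \<noteq> \<infinity>" and "f x \<noteq> -\<infinity>"
    by (auto simp: proper_def)
  moreover have "f x + ereal (q x) \<le> f z + ereal (q z)"
    using min by (simp add: argmin_set_iff)
  ultimately show ?thesis by (cases "f x"; cases "f z") auto
qed

lemma frechet_subdiff_subset_lim_subdiff: "frechet_subdiff f x \<subseteq> lim_subdiff f x"
proof
  fix v assume v: "v \<in> frechet_subdiff f x"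
  then show "v \<in> lim_subdiff f x"
    unfolding lim_subdiff_def
    by (intro CollectI conjI exI[of _ "\<lambda>_. x"] exI[of _ "\<lambda>_. v"])
      (auto simp: frechet_subdiff_def)
qed

text \<open>A global lower bound with a quadratic error term is far more than the Frechet condition
  asks for, but both Fermat rules below produce their subgradients in this form.\<close>

lemma quadratic_minorant_imp_lim_subdiff:
  fixes f :: "'a::real_inner \<Rightarrow> ereal"
  assumes fin: "\<bar>f x\<bar> \<noteq> \<infinity>"
    and minorant: "\<And>z. f x + ereal (v \<bullet> (z - x) - c * (norm (z - x))\<^sup>2) \<le> f z"
  shows "v \<in> lim_subdiff f x"
proof -
  have "(\<lambda>z. - c * (norm (z - x))\<^sup>2) \<in> o[at x](\<lambda>z. norm (z - x))"
  proof (rule smalloI_tendsto)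
    have "((\<lambda>z. - c * norm (z - x)) \<longlongrightarrow> - c * norm (x - x)) (at x)"
      by (intro tendsto_intros)
    moreover have "\<forall>\<^sub>F z in at x. - c * norm (z - x) = - c * (norm (z - x))\<^sup>2 / norm (z - x)"
      by (simp add: eventually_at_filter power2_eq_square)
    ultimately show "((\<lambda>z. - c * (norm (z - x))\<^sup>2 / norm (z - x)) \<longlongrightarrow> 0) (at x)"
      using Lim_transform_eventually by fastforce
    show "\<forall>\<^sub>F z in at x. norm (z - x) \<noteq> 0"
      by (simp add: eventually_at_filter)
  qed
  then have "v \<in> frechet_subdiff f x"
    unfolding frechet_subdiff_def using fin minorant
    by (intro CollectI conjI exI[of _ "\<lambda>z. - c * (norm (z - x))\<^sup>2"]) auto
  then show ?thesis
    using frechet_subdiff_subset_lim_subdiff by blast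
qed

lemma lim_subdiff_prox:
  fixes h :: "'a::real_inner \<Rightarrow> ereal"
  assumes "proper h" and prox: "w \<in> prox \<nu> h y"
  shows "(1 / \<nu>) *\<^sub>R (y - w) \<in> lim_subdiff h w"
proof (rule quadratic_minorant_imp_lim_subdiff)
  note min = prox[unfolded prox_def]
  show fin: "\<bar>h w\<bar> \<noteq> \<infinity>"
    by (rule argmin_add_real_finite[OF \<open>proper h\<close> min])
  fix z
  have "h w + ereal (1 / (2 * \<nu>) * (norm (w - y))\<^sup>2) \<le> h z + ereal (1 / (2 * \<nu>) * (norm (z - y))\<^sup>2)"
    using min by (simp add: argmin_set_iff)
  moreover have "1 / (2 * \<nu>) * (norm (w - y))\<^sup>2 - 1 / (2 * \<nu>) * (norm (z - y))\<^sup>2 =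
      (1 / \<nu>) *\<^sub>R (y - w) \<bullet> (z - w) - 1 / (2 * \<nu>) * (norm (z - w))\<^sup>2"
    by (cases "\<nu> = 0")
      (simp_all add: power2_norm_eq_inner inner_diff_left inner_diff_right inner_commute field_simps)
  ultimately show "h w + ereal ((1 / \<nu>) *\<^sub>R (y - w) \<bullet> (z - w) - 1 / (2 * \<nu>) * (norm (z - w))\<^sup>2) \<le> h z"
    using fin by (cases "h w"; cases "h z") auto
qed

section \<open>Quadratic growth of the penalized convex problem\<close>

text \<open>Minimality between \<open>x\<close> and \<open>x + t (z - x)\<close> combined with convexity leaves, after
  division by \<open>t\<close>, an error of order \<open>t\<close>, which vanishes in the limit.\<close>

lemma penalized_subgradient:
  fixes g :: "'a::real_vector \<Rightarrow> ereal" and L :: "'a \<Rightarrow> 'b::real_inner"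
  assumes "ereal_convex g" "proper g" "linear L"
    and min: "x \<in> argmin_set (\<lambda>z. g z + ereal (c * (norm (L z - w))\<^sup>2))"
  shows "g x + ereal (2 * c * ((w - L x) \<bullet> (L z - L x))) \<le> g z"
proof (cases "g z")
  case (real b)
  from argmin_add_real_finite[OF \<open>proper g\<close> min] obtain a where a: "g x = ereal a"
    by (cases "g x") auto
  define r d where "r = L x - w" and "d = L z - L x"
  have bound: "a \<le> b + 2 * c * (r \<bullet> d) + c * t * (norm d)\<^sup>2" if t: "0 < t" "t < 1" for t
  proof -
    let ?y = "(1 - t) *\<^sub>R x + t *\<^sub>R z"
    have conv: "g ?y \<le> ereal ((1 - t) * a + t * b)"
      using \<open>ereal_convex g\<close>[unfolded ereal_convex_def, rule_format, of t x z] t by (simp add: a real)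
    have "L ?y - w = r + t *\<^sub>R d"
      by (simp add: linear_add[OF \<open>linear L\<close>] linear_diff[OF \<open>linear L\<close>] linear_scale[OF \<open>linear L\<close>] r_def d_def algebra_simps)
    moreover have "g x + ereal (c * (norm r)\<^sup>2) \<le> g ?y + ereal (c * (norm (L ?y - w))\<^sup>2)"
      using min by (simp add: argmin_set_iff r_def)
    ultimately have "a + c * (norm r)\<^sup>2 \<le> (1 - t) * a + t * b + c * (norm (r + t *\<^sub>R d))\<^sup>2"
      using conv by (cases "g ?y") (auto simp: a)
    then have "t * a \<le> t * (b + 2 * c * (r \<bullet> d) + c * t * (norm d)\<^sup>2)"
      by (simp add: power2_norm_eq_inner inner_add_left inner_add_right inner_commute algebra_simps)
    then show ?thesis using t by simp
  qed
  have "a \<le> b + 2 * c * (r \<bullet> d) + c * 0 * (norm d)\<^sup>2"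
  proof (rule tendsto_lowerbound)
    show "((\<lambda>t. b + 2 * c * (r \<bullet> d) + c * t * (norm d)\<^sup>2) \<longlongrightarrow>
        b + 2 * c * (r \<bullet> d) + c * 0 * (norm d)\<^sup>2) (at_right 0)"
      by (intro tendsto_intros)
    show "\<forall>\<^sub>F t in at_right 0. a \<le> b + 2 * c * (r \<bullet> d) + c * t * (norm d)\<^sup>2"
      using bound by (auto simp: eventually_at_right_field intro!: exI[of _ 1])
  qed simp
  moreover have "(w - L x) \<bullet> d = - (r \<bullet> d)"
    by (simp add: r_def inner_diff_left)
  ultimately show ?thesis
    by (simp add: a real d_def[symmetric])
qed (use \<open>proper g\<close> in \<open>auto simp: proper_def\<close>)

text \<open>Adding the exact expansion of \<open>\<parallel>L z - u\<parallel>\<^sup>2\<close> around \<open>L x - w\<close> to the subgradient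
  inequality cancels every term that is linear in \<open>L z\<close>.  Having \<open>z\<close> and \<open>u\<close> free at once
  lets the same inequality bound the envelope from below and measure the gain of
  re-minimizing at the same \<open>w\<close>.\<close>

lemma penalized_growth:
  fixes g :: "'a::real_vector \<Rightarrow> ereal" and L :: "'a \<Rightarrow> 'b::real_inner"
  assumes "ereal_convex g" "proper g" "linear L"
    and min: "x \<in> argmin_set (\<lambda>z. g z + ereal (c * (norm (L z - w))\<^sup>2))"
  shows "g x + ereal (c * (norm (L x - w))\<^sup>2 + 2 * c * ((w - L x) \<bullet> (u - w))
      + c * (norm (L z - L x - (u - w)))\<^sup>2) \<le> g z + ereal (c * (norm (L z - u))\<^sup>2)"
proof -
  have "L z - u = (L x - w) + (L z - L x - (u - w))"
    by simp
  then have "(norm (L z - u))\<^sup>2 = (norm (L x - w))\<^sup>2 + 2 * ((L x - w) \<bullet> (L z - L x - (u - w)))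
      + (norm (L z - L x - (u - w)))\<^sup>2"
    by (simp only: power2_norm_eq_inner inner_add_left inner_add_right inner_commute)
  moreover have "(L x - w) \<bullet> (L z - L x - (u - w)) =
      (w - L x) \<bullet> (u - w) - (w - L x) \<bullet> (L z - L x)"
    by (simp add: inner_diff_left inner_diff_right)
  ultimately have "(norm (L z - u))\<^sup>2 = (norm (L x - w))\<^sup>2 + 2 * ((w - L x) \<bullet> (u - w))
      + (norm (L z - L x - (u - w)))\<^sup>2 - 2 * ((w - L x) \<bullet> (L z - L x))"
    by linarith
  then have "c * (norm (L z - u))\<^sup>2 = c * (norm (L x - w))\<^sup>2 + 2 * c * ((w - L x) \<bullet> (u - w))
      + c * (norm (L z - L x - (u - w)))\<^sup>2 - 2 * c * ((w - L x) \<bullet> (L z - L x))"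
    by (simp only: distrib_left right_diff_distrib ac_simps)
  then show ?thesis
    using penalized_subgradient[OF assms, of z] by (cases "g x"; cases "g z") auto
qed

lemma lim_subdiff_penalized:
  fixes g :: "real ^ 'n \<Rightarrow> ereal" and A :: "real ^ 'n ^ 'm"
  assumes "ereal_convex g" "proper g" and min: "x \<in> argmin_set (penalized \<nu> g A w)"
  shows "(1 / \<nu>) *\<^sub>R (transpose A *v (w - A *v x)) \<in> lim_subdiff g x"
proof (rule quadratic_minorant_imp_lim_subdiff[where c = 0])
  have min': "x \<in> argmin_set (\<lambda>z. g z + ereal (1 / (2 * \<nu>) * (norm (A *v z - w))\<^sup>2))"
    using min by (simp add: penalized_def[abs_def])
  show "\<bar>g x\<bar> \<noteq> \<infinity>"
    by (rule argmin_add_real_finite[OF \<open>proper g\<close> min'])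
  fix z
  have "(w - A *v x) \<bullet> (A *v z - A *v x) = (transpose A *v (w - A *v x)) \<bullet> (z - x)"
    by (simp add: dot_lmul_matrix flip: matrix_vector_mult_diff_distrib)
  then show "g x + ereal ((1 / \<nu>) *\<^sub>R (transpose A *v (w - A *v x)) \<bullet> (z - x) - 0 * (norm (z - x))\<^sup>2) \<le> g z"
    using penalized_subgradient[OF assms(1,2) matrix_vector_mul_linear min', of z] by simp
qed

section \<open>The envelope and its gradient\<close>

lemma g_env_argmin: "x \<in> argmin_set (penalized \<nu> g A w) \<Longrightarrow> g_env \<nu> g A w = penalized \<nu> g A w x"
  unfolding g_env_def by (rule antisym) (auto simp: argmin_set_iff intro: INF_lower INF_greatest)

text \<open>The lower bound is quadratic growth with the last square dropped; the upper bound keeps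
  the old minimizer \<open>x\<close> as a competitor at \<open>u\<close>.\<close>

lemma g_env_bounds:
  fixes g :: "real ^ 'n \<Rightarrow> ereal" and A :: "real ^ 'n ^ 'm"
  assumes "ereal_convex g" "proper g" "\<nu> > 0" and min: "x \<in> argmin_set (penalized \<nu> g A w)"
  shows "g_env \<nu> g A w + ereal ((1 / \<nu>) *\<^sub>R (w - A *v x) \<bullet> (u - w)) \<le> g_env \<nu> g A u"
    and "g_env \<nu> g A u \<le> g_env \<nu> g A w +
      ereal ((1 / \<nu>) *\<^sub>R (w - A *v x) \<bullet> (u - w) + 1 / (2 * \<nu>) * (norm (u - w))\<^sup>2)"
proof -
  have min': "x \<in> argmin_set (\<lambda>z. g z + ereal (1 / (2 * \<nu>) * (norm (A *v z - w))\<^sup>2))"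
    using min by (simp add: penalized_def[abs_def])
  show "g_env \<nu> g A w + ereal ((1 / \<nu>) *\<^sub>R (w - A *v x) \<bullet> (u - w)) \<le> g_env \<nu> g A u"
    unfolding g_env_argmin[OF min] unfolding g_env_def
  proof (rule INF_greatest)
    fix z
    have "penalized \<nu> g A w x + ereal ((1 / \<nu>) *\<^sub>R (w - A *v x) \<bullet> (u - w)) \<le>
      g x + ereal (1 / (2 * \<nu>) * (norm (A *v x - w))\<^sup>2 + 2 * (1 / (2 * \<nu>)) * ((w - A *v x) \<bullet> (u - w))
      + 1 / (2 * \<nu>) * (norm (A *v z - A *v x - (u - w)))\<^sup>2)"
      using \<open>\<nu> > 0\<close> by (cases "g x") (auto simp: penalized_def)
    also have "\<dots> \<le> penalized \<nu> g A u z"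
      unfolding penalized_def
      by (rule penalized_growth[OF assms(1,2) matrix_vector_mul_linear min'])
    finally show "penalized \<nu> g A w x + ereal ((1 / \<nu>) *\<^sub>R (w - A *v x) \<bullet> (u - w)) \<le> penalized \<nu> g A u z" .
  qed
  have "A *v x - u = (A *v x - w) - (u - w)"
    by simp
  then have "(norm (A *v x - u))\<^sup>2 = (norm (A *v x - w))\<^sup>2 + 2 * ((w - A *v x) \<bullet> (u - w)) + (norm (u - w))\<^sup>2"
    by (simp only: power2_norm_eq_inner inner_diff_left inner_diff_right inner_commute) simp
  then have "1 / (2 * \<nu>) * (norm (A *v x - u))\<^sup>2 = 1 / (2 * \<nu>) * (norm (A *v x - w))\<^sup>2 +
      ((1 / \<nu>) *\<^sub>R (w - A *v x) \<bullet> (u - w) + 1 / (2 * \<nu>) * (norm (u - w))\<^sup>2)"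
    using \<open>\<nu> > 0\<close> by (simp only: inner_scaleR_left) (simp add: field_simps)
  then have "penalized \<nu> g A u x = penalized \<nu> g A w x +
      ereal ((1 / \<nu>) *\<^sub>R (w - A *v x) \<bullet> (u - w) + 1 / (2 * \<nu>) * (norm (u - w))\<^sup>2)"
    by (simp add: penalized_def add.assoc)
  moreover have "g_env \<nu> g A u \<le> penalized \<nu> g A u x"
    unfolding g_env_def by (rule INF_lower) simp
  ultimately show "g_env \<nu> g A u \<le> g_env \<nu> g A w +
      ereal ((1 / \<nu>) *\<^sub>R (w - A *v x) \<bullet> (u - w) + 1 / (2 * \<nu>) * (norm (u - w))\<^sup>2)"
    by (simp add: g_env_argmin[OF min])
qed

text \<open>At other points the infimum need not be attained, but the two bounds carry finiteness
  over from \<open>w\<close>.\<close>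

lemma g_env_finite:
  fixes g :: "real ^ 'n \<Rightarrow> ereal" and A :: "real ^ 'n ^ 'm"
  assumes "ereal_convex g" "proper g" "\<nu> > 0" and min: "x \<in> argmin_set (penalized \<nu> g A w)"
  shows "\<bar>g_env \<nu> g A u\<bar> \<noteq> \<infinity>"
proof -
  have "\<bar>g x\<bar> \<noteq> \<infinity>"
    using argmin_add_real_finite[OF \<open>proper g\<close>] min by (simp add: penalized_def[abs_def])
  then have "\<bar>g_env \<nu> g A w\<bar> \<noteq> \<infinity>"
    by (auto simp: g_env_argmin[OF min] penalized_def)
  then show ?thesis
    using g_env_bounds[OF assms, of u] by (cases "g_env \<nu> g A w"; cases "g_env \<nu> g A u") auto
qed

lemma GDERIV_squeeze:
  fixes f :: "'a::real_inner \<Rightarrow> real"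
  assumes "\<And>u. f w + D \<bullet> (u - w) \<le> f u"
    and "\<And>u. f u \<le> f w + D \<bullet> (u - w) + c * (norm (u - w))\<^sup>2"
  shows "GDERIV f w :> D"
  unfolding gderiv_def has_derivative_at_within
proof (intro conjI)
  show "bounded_linear (\<lambda>u. u \<bullet> D)" by (rule bounded_linear_inner_left)
  let ?e = "\<lambda>u. (f u - f w - (u - w) \<bullet> D) /\<^sub>R norm (u - w)"
  have lim: "((\<lambda>u. c * norm (u - w)) \<longlongrightarrow> c * norm (w - w)) (at w)"
    by (intro tendsto_intros)
  have "norm (?e u) \<le> c * norm (u - w)" for u
  proof (cases "u = w")
    case False
    then show ?thesis
      using assms[of u] by (simp add: inner_commute[of D] field_simps power2_eq_square)
  qed simp
  then show "(?e \<longlongrightarrow> 0) (at w)"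
    by (intro Lim_null_comparison[OF _ lim[simplified]]) simp
qed

lemma gradient_eqI:
  assumes "GDERIV f w :> D"
  shows "gradient f w = D"
  unfolding gradient_def
proof (rule the_equality)
  show "GDERIV f w :> D" by (rule assms)
  fix E assume "GDERIV f w :> E"
  then have "(\<lambda>u. u \<bullet> E) = (\<lambda>u. u \<bullet> D)"
    using assms unfolding gderiv_def by (rule has_derivative_unique)
  then have "(E - D) \<bullet> E = (E - D) \<bullet> D"
    by metis
  then have "(E - D) \<bullet> (E - D) = 0"
    by (simp add: inner_diff_right)
  then show "E = D" by simp
qed

lemma grad_g_env_eq:
  fixes g :: "real ^ 'n \<Rightarrow> ereal" and A :: "real ^ 'n ^ 'm"
  assumes "ereal_convex g" "proper g" "\<nu> > 0" and min: "x \<in> argmin_set (penalized \<nu> g A w)"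
  shows "grad_g_env \<nu> g A w = (1 / \<nu>) *\<^sub>R (w - A *v x)"
  unfolding grad_g_env_def
proof (intro gradient_eqI GDERIV_squeeze[where c = "1 / (2 * \<nu>)"])
  define e where "e u = real_of_ereal (g_env \<nu> g A u)" for u
  have "g_env \<nu> g A u = ereal (e u)" for u
    using g_env_finite[OF assms, of u] by (simp add: e_def ereal_real)
  with g_env_bounds[OF assms]
  show "real_of_ereal (g_env \<nu> g A w) + (1 / \<nu>) *\<^sub>R (w - A *v x) \<bullet> (u - w) \<le> real_of_ereal (g_env \<nu> g A u)"
    and "real_of_ereal (g_env \<nu> g A u) \<le> real_of_ereal (g_env \<nu> g A w) +
      (1 / \<nu>) *\<^sub>R (w - A *v x) \<bullet> (u - w) + 1 / (2 * \<nu>) * (norm (u - w))\<^sup>2" for u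
    by (simp_all add: add.assoc)
qed

section \<open>Sufficient decrease and the rate\<close>

text \<open>The intermediate value is \<open>h w' + penalized \<nu> g A w' x\<close>: it is at most \<open>p_obj \<nu> h g A w\<close>
  by minimality of \<open>w'\<close>, and it exceeds \<open>p_obj \<nu> h g A w'\<close> by quadratic growth around \<open>x'\<close>.\<close>

lemma p_obj_decrease:
  fixes g :: "real ^ 'n \<Rightarrow> ereal" and A :: "real ^ 'n ^ 'm"
  assumes "ereal_convex g" "proper g"
    and min: "x \<in> argmin_set (penalized \<nu> g A w)"
    and min': "x' \<in> argmin_set (penalized \<nu> g A w')"
    and prox: "w' \<in> prox \<nu> h (A *v x)"
  shows "p_obj \<nu> h g A w' + ereal (1 / (2 * \<nu>) * (norm (A *v (x - x')))\<^sup>2) \<le> p_obj \<nu> h g A w"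
proof -
  let ?q = "\<lambda>z u. 1 / (2 * \<nu>) * (norm (A *v z - u))\<^sup>2"
  have "x' \<in> argmin_set (\<lambda>z. g z + ereal (?q z w'))"
    using min' by (simp add: penalized_def[abs_def])
  from penalized_growth[OF assms(1,2) matrix_vector_mul_linear this, of w' x]
  have growth: "penalized \<nu> g A w' x' + ereal (1 / (2 * \<nu>) * (norm (A *v (x - x')))\<^sup>2) \<le> g x + ereal (?q x w')"
    by (simp add: penalized_def matrix_vector_mult_diff_distrib add.assoc)
  have "p_obj \<nu> h g A w' + ereal (1 / (2 * \<nu>) * (norm (A *v (x - x')))\<^sup>2) \<le> h w' + (g x + ereal (?q x w'))"
    unfolding p_obj_def g_env_argmin[OF min'] add.assoc
    by (rule add_left_mono[OF growth])
  also have "\<dots> = g x + (h w' + ereal (?q x w'))"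
    by (simp add: ac_simps)
  also have "\<dots> \<le> g x + (h w + ereal (?q x w))"
    using prox by (intro add_left_mono) (simp add: prox_def argmin_set_iff norm_minus_commute)
  also have "\<dots> = p_obj \<nu> h g A w"
    by (simp add: p_obj_def g_env_argmin[OF min] penalized_def ac_simps)
  finally show ?thesis .
qed

lemma sum_le_of_decrease:
  fixes P :: "nat \<Rightarrow> ereal"
  assumes "\<And>k. P (Suc k) + ereal (d (Suc k)) \<le> P k"
  shows "P k + ereal (\<Sum>i=1..k. d i) \<le> P 0"
proof (induction k)
  case (Suc k)
  have "P (Suc k) + ereal (\<Sum>i=1..Suc k. d i) = (P (Suc k) + ereal (d (Suc k))) + ereal (\<Sum>i=1..k. d i)"
    by (simp add: ac_simps)
  also have "\<dots> \<le> P k + ereal (\<Sum>i=1..k. d i)"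
    by (rule add_right_mono) (rule assms)
  finally show ?case
    using Suc by simp
qed simp

theorem theorem4:
  fixes h :: "real ^ 'm \<Rightarrow> ereal"
    and g :: "real ^ 'n \<Rightarrow> ereal"
    and A :: "real ^ 'n ^ 'm"
    and \<nu> :: real
    and w :: "nat \<Rightarrow> real ^ 'm"
    and x :: "nat \<Rightarrow> real ^ 'n"
  assumes h_closed_proper: "lsc h" "proper h"
    and g_closed_proper: "lsc g" "proper g"
    and h_separable: "separable h"
    and h_prox_bounded: "prox_bounded h"
    and g_convex: "ereal_convex g"
    and nu_pos: "\<nu> > 0"
    and prox_nonempty: "\<forall>y. prox \<nu> h y \<noteq> {}"
    and p_bounded_below: "\<exists>c::real. \<forall>u. ereal c \<le> p_obj \<nu> h g A u"
    and p_attained: "argmin_set (p_obj \<nu> h g A) \<noteq> {}"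
    and x_step: "\<forall>k. x k \<in> argmin_set (\<lambda>z. g z + ereal (1 / (2 * \<nu>) * (norm (A *v z - w k))\<^sup>2))"
    and w_step: "\<forall>k. w (Suc k) \<in> prox \<nu> h (w k - \<nu> *\<^sub>R grad_g_env \<nu> g A (w k))"
  shows "(\<forall>k. prox \<nu> h (w k - \<nu> *\<^sub>R grad_g_env \<nu> g A (w k)) = prox \<nu> h (A *v x k)) \<and>
    (\<forall>k\<ge>1.
        (1 / \<nu>) *\<^sub>R (A *v (x (k - 1) - x k))
          \<in> (\<lambda>s. s + (1 / \<nu>) *\<^sub>R (w k - A *v x k)) ` lim_subdiff h (w k) \<and>
        0 \<in> (\<lambda>s. s + (1 / \<nu>) *\<^sub>R (transpose A *v (A *v x k - w k))) ` lim_subdiff g (x k)) \<and>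
    (\<forall>k\<ge>1.
        ereal (1 / real k) * (\<Sum>i=1..k. T_opt \<nu> h g A (w i))
          \<le> ereal (1 / real k * (\<Sum>i=1..k. (norm ((1 / \<nu>) *\<^sub>R (A *v (x (i - 1) - x i))))\<^sup>2)) \<and>
        ereal (1 / real k * (\<Sum>i=1..k. (norm ((1 / \<nu>) *\<^sub>R (A *v (x (i - 1) - x i))))\<^sup>2))
          \<le> ereal (2 / (\<nu> * real k)) * (p_obj \<nu> h g A (w 0) - p_star \<nu> h g A))"
proof -
  have min: "x k \<in> argmin_set (penalized \<nu> g A (w k))" for k
    using x_step by (simp add: penalized_def[abs_def])
  note grad = grad_g_env_eq[OF g_convex g_closed_proper(2) nu_pos min]
  have "w k - \<nu> *\<^sub>R grad_g_env \<nu> g A (w k) = A *v x k" for k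
    using nu_pos by (simp add: grad)
  then have step: "prox \<nu> h (w k - \<nu> *\<^sub>R grad_g_env \<nu> g A (w k)) = prox \<nu> h (A *v x k)" for k
    by simp
  with w_step have w_prox: "w (Suc k) \<in> prox \<nu> h (A *v x k)" for k
    by simp
  define v where "v k = (1 / \<nu>) *\<^sub>R (A *v (x (k - 1) - x k))" for k

  have incl_h: "v k \<in> (\<lambda>s. s + (1 / \<nu>) *\<^sub>R (w k - A *v x k)) ` lim_subdiff h (w k)"
    if "k \<ge> 1" for k
  proof (rule image_eqI)
    show "(1 / \<nu>) *\<^sub>R (A *v x (k - 1) - w k) \<in> lim_subdiff h (w k)"
      using lim_subdiff_prox[OF h_closed_proper(2) w_prox[of "k - 1"]] that by simp
    show "v k = (1 / \<nu>) *\<^sub>R (A *v x (k - 1) - w k) + (1 / \<nu>) *\<^sub>R (w k - A *v x k)"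
      by (simp add: v_def matrix_vector_mult_diff_distrib algebra_simps)
  qed
  have incl_g: "0 \<in> (\<lambda>s. s + (1 / \<nu>) *\<^sub>R (transpose A *v (A *v x k - w k))) ` lim_subdiff g (x k)" for k
  proof (rule image_eqI)
    show "(1 / \<nu>) *\<^sub>R (transpose A *v (w k - A *v x k)) \<in> lim_subdiff g (x k)"
      by (rule lim_subdiff_penalized[OF g_convex g_closed_proper(2) min])
    show "0 = (1 / \<nu>) *\<^sub>R (transpose A *v (w k - A *v x k)) + (1 / \<nu>) *\<^sub>R (transpose A *v (A *v x k - w k))"
      by (simp add: matrix_vector_mult_diff_distrib algebra_simps)
  qed

  have "T_opt \<nu> h g A (w i) \<le> ereal ((norm (v i))\<^sup>2)" if "i \<ge> 1" for i
    unfolding T_opt_def using incl_h[OF that] by (intro INF_lower) (simp add: T_set_def grad)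
  then have "(\<Sum>i=1..k. T_opt \<nu> h g A (w i)) \<le> (\<Sum>i=1..k. ereal ((norm (v i))\<^sup>2))" for k
    by (intro sum_mono) simp
  then have avg: "ereal (1 / real k) * (\<Sum>i=1..k. T_opt \<nu> h g A (w i))
      \<le> ereal (1 / real k * (\<Sum>i=1..k. (norm (v i))\<^sup>2))" for k
    using ereal_mult_left_mono[of _ "ereal (\<Sum>i=1..k. (norm (v i))\<^sup>2)" "ereal (1 / real k)"]
    by simp

  let ?P = "p_obj \<nu> h g A"
  have rate: "ereal (1 / real k * (\<Sum>i=1..k. (norm (v i))\<^sup>2))
      \<le> ereal (2 / (\<nu> * real k)) * (?P (w 0) - p_star \<nu> h g A)" if k: "k \<ge> 1" for k
  proof -
    define S where "S = (\<Sum>i=1..k. (norm (v i))\<^sup>2)"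
    have "1 / (2 * \<nu>) * (norm (A *v (x (i - 1) - x i)))\<^sup>2 = \<nu> / 2 * (norm (v i))\<^sup>2" for i
      using nu_pos by (simp add: v_def power_divide power2_eq_square field_simps)
    then have "?P (w (Suc i)) + ereal (\<nu> / 2 * (norm (v (Suc i)))\<^sup>2) \<le> ?P (w i)" for i
      using p_obj_decrease[OF g_convex g_closed_proper(2) min min w_prox, of i] by (metis diff_Suc_1)
    from sum_le_of_decrease[where P = "\<lambda>k. ?P (w k)", OF this]
    have "?P (w k) + ereal (\<nu> / 2 * S) \<le> ?P (w 0)"
      by (simp add: S_def sum_distrib_left)
    moreover have "p_star \<nu> h g A \<le> ?P (w k)"
      unfolding p_star_def by (rule INF_lower) simp
    ultimately have main: "p_star \<nu> h g A + ereal (\<nu> / 2 * S) \<le> ?P (w 0)"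
      using add_right_mono order_trans by blast
    have "p_star \<nu> h g A \<noteq> -\<infinity>"
    proof -
      from p_bounded_below obtain c where "\<And>u. ereal c \<le> ?P u" by blast
      then have "ereal c \<le> p_star \<nu> h g A" unfolding p_star_def by (rule INF_greatest)
      then show ?thesis by auto
    qed
    moreover have "p_star \<nu> h g A \<noteq> \<infinity>"
    proof -
      from h_closed_proper(2) obtain u where "h u \<noteq> \<infinity>" by (auto simp: proper_def)
      then have "?P u \<noteq> \<infinity>"
        using g_env_finite[OF g_convex g_closed_proper(2) nu_pos min, of u] by (auto simp: p_obj_def)
      moreover have "p_star \<nu> h g A \<le> ?P u"
        unfolding p_star_def by (rule INF_lower) simp
      ultimately show ?thesis by auto
    qed
    ultimately obtain c where c: "p_star \<nu> h g A = ereal c"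
      by (cases "p_star \<nu> h g A") auto
    \<comment> \<open>Only the starting point may lie outside the domain of \<open>h\<close>; the bound is then infinite.\<close>
    have "ereal (1 / real k * S) \<le> ereal (2 / (\<nu> * real k)) * (?P (w 0) - p_star \<nu> h g A)"
    proof (cases "?P (w 0)")
      case (real b)
      then have "1 / real k * S \<le> 2 / (\<nu> * real k) * (b - c)"
        using main nu_pos k by (simp add: c field_simps)
      then show ?thesis by (simp add: real c)
    qed (use main nu_pos k in \<open>auto simp: c\<close>)
    then show ?thesis by (simp add: S_def)
  qed

  show ?thesis
    unfolding v_def[symmetric] using step incl_h incl_g avg rate by blast
qed

end
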